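(* Let $(X,S)$ and $(Y,S)$ be aperiodic subshifts. Suppose $(X,S)$ is linearly recurrent for the constant $K$. Then there exist $N\le (2(K+1))^{36(K+1)^5}$ and factor maps $f_i:(X,S)\to(Y,S)$, $1\le i\le N$, such that if $f:(X,S)\to(Y,S)$ is a factor map then there exist $k\in\mathbb Z$ and $i\in\{1,\dots,N\}$ such that $f=S^k\circ f_i$.
   Context: Alphabets are finite. $S$ is the shift $(x_n)_n\mapsto(x_{n+1})_n$ on $A^{\mathbb Z}$. A subshift is a pair $(X,S)$ with $X\subset A^{\mathbb Z}$ closed (product topology) and $S^{-1}X=X$. It is aperiodic if there is no $x\in X$ with $S^nx=x$ for some $n>0$. A factor map $f:(X,S)\to(Y,S)$ is a continuous onto map with $f\circ S=S\circ f$. For a sequence $x$, $\mathcal L(x)$ is the set of finite words occurring in $x$ and $\Omega(x)=\{y\in A^{\mathbb Z}:\mathcal L(y)\subset\mathcal L(x)\}$. A sequence $x$ is recurrent if each word occurring in $x$ occurs infinitely often in $(x_n)_{n\ge0}$ (and in $(x_n)_{n<0}$ when $x$ is two-sided). It is linearly recurrent for the constant $K$ if it is recurrent and, for every non-empty word $u\in\mathcal L(x)$, the difference between two successive occurrences of $u$ in $x$ is at most $K|u|$. A subshift is linearly recurrent for the constant $K$ if it is of the form $(\Omega(x),S)$ for a sequence $x$ that is linearly recurrent for the constant $K$. The number $N$ is a non-negative integer ($N=0$ corresponds to there being no factor map). *)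

theory Defs
  imports "HOL-Analysis.Function_Topology"
begin

(* Alphabets are types of class finite, and A^Z is the type int => 'a. *)

definition full_shift_topology :: "(int \<Rightarrow> 'a) topology" where
  "full_shift_topology = product_topology (\<lambda>_. discrete_topology UNIV) UNIV"

definition shift :: "(int \<Rightarrow> 'a) \<Rightarrow> (int \<Rightarrow> 'a)" where
  "shift x = (\<lambda>n. x (n + 1))"

definition shift_pow :: "int \<Rightarrow> (int \<Rightarrow> 'a) \<Rightarrow> (int \<Rightarrow> 'a)" where
  "shift_pow k = (if 0 \<le> k then shift ^^ nat k else inv shift ^^ nat (- k))"

lemma inv_shift: "inv shift = (\<lambda>(x :: int \<Rightarrow> 'a) n. x (n - 1))"
proof
  fix x :: "int \<Rightarrow> 'a"
  have "inj (shift :: (int \<Rightarrow> 'a) \<Rightarrow> _)"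
  proof (rule injI)
    fix x y :: "int \<Rightarrow> 'a"
    assume "shift x = shift y"
    then have "x ((n - 1) + 1) = y ((n - 1) + 1)" for n
      unfolding shift_def by (rule fun_cong)
    then show "x = y" by auto
  qed
  moreover have "shift (\<lambda>n. x (n - 1)) = x"
    by (simp add: shift_def)
  ultimately show "inv shift x = (\<lambda>n. x (n - 1))"
    by (metis inv_f_f)
qed

lemma shift_pow_apply: "shift_pow k x n = x (n + k)"
proof -
  have "(shift ^^ m) x n = x (n + int m)" for m n
    by (induction m arbitrary: n) (simp_all add: shift_def algebra_simps)
  moreover have "(inv shift ^^ m) x n = x (n - int m)" for m n
    by (induction m arbitrary: n) (simp_all add: inv_shift algebra_simps)
  ultimately show ?thesis
    by (simp add: shift_pow_def)
qed

definition subshift :: "(int \<Rightarrow> 'a::finite) set \<Rightarrow> bool" where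
  "subshift X \<longleftrightarrow> closedin full_shift_topology X \<and> shift -` X = X"

definition aperiodic :: "(int \<Rightarrow> 'a) set \<Rightarrow> bool" where
  "aperiodic X \<longleftrightarrow> \<not> (\<exists>x\<in>X. \<exists>n::nat. n > 0 \<and> (shift ^^ n) x = x)"

(* Only the values of f on X matter. *)
definition factor_map ::
    "(int \<Rightarrow> 'a) set \<Rightarrow> (int \<Rightarrow> 'b) set \<Rightarrow> ((int \<Rightarrow> 'a) \<Rightarrow> (int \<Rightarrow> 'b)) \<Rightarrow> bool" where
  "factor_map X Y f \<longleftrightarrow>
     continuous_map (subtopology full_shift_topology X) (subtopology full_shift_topology Y) f \<and>
     f ` X = Y \<and> (\<forall>x\<in>X. f (shift x) = shift (f x))"

(* A sequence is a function x on int read only on an index set I: I = UNIV for a two-sided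
   sequence, I = {0..} for a one-sided one (the values of x outside I are then irrelevant). *)

definition occurrences :: "int set \<Rightarrow> (int \<Rightarrow> 'a) \<Rightarrow> 'a list \<Rightarrow> int set" where
  "occurrences I x u =
     {n. {n ..< n + int (length u)} \<subseteq> I \<and> n \<in> I \<and> (\<forall>j < length u. x (n + int j) = u ! j)}"

definition language :: "int set \<Rightarrow> (int \<Rightarrow> 'a) \<Rightarrow> 'a list set" where
  "language I x = {u. occurrences I x u \<noteq> {}}"

definition Omega :: "int set \<Rightarrow> (int \<Rightarrow> 'a) \<Rightarrow> (int \<Rightarrow> 'a) set" where
  "Omega I x = {y. language UNIV y \<subseteq> language I x}"

definition recurrent :: "int set \<Rightarrow> (int \<Rightarrow> 'a) \<Rightarrow> bool" where
  "recurrent I x \<longleftrightarrow>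
     (\<forall>u\<in>language I x. infinite (occurrences {0..} x u) \<and>
        (I = UNIV \<longrightarrow> infinite (occurrences {..<0} x u)))"

definition linearly_recurrent :: "int set \<Rightarrow> real \<Rightarrow> (int \<Rightarrow> 'a) \<Rightarrow> bool" where
  "linearly_recurrent I K x \<longleftrightarrow> recurrent I x \<and>
     (\<forall>u\<in>language I x. u \<noteq> [] \<longrightarrow>
        (\<forall>m\<in>occurrences I x u. \<forall>n\<in>occurrences I x u.
           m < n \<and> {m<..<n} \<inter> occurrences I x u = {} \<longrightarrow>
           real_of_int (n - m) \<le> K * real (length u)))"

definition linearly_recurrent_subshift :: "real \<Rightarrow> (int \<Rightarrow> 'a::finite) set \<Rightarrow> bool" where
  "linearly_recurrent_subshift K X \<longleftrightarrow>
     (\<exists>I x. (I = UNIV \<or> I = {0..}) \<and> linearly_recurrent I K x \<and> X = Omega I x)"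

end

theory Submission
  imports Defs
begin

text \<open>
  A factor map of subshifts is a sliding block code, so finitely many factor maps
  \<open>X \<rightarrow> Y\<close> share a radius \<open>r\<close>. A sliding block code is determined by its effect on a stretch of
  a single sequence \<open>x \<in> X\<close>, as soon as that stretch shows every word of \<open>X\<close> that fits the window.
  Linear recurrence makes such a stretch short: with \<open>c = \<lceil>K\<rceil>\<close>, every word of length \<open>n\<close> occurs
  at one of any \<open>c n\<close> consecutive positions of \<open>x\<close>
  (\<open>linearly_recurrent_imp_uniformly_recurrent\<close>). The image \<open>Y\<close> inherits this property with constant
  \<open>2 c\<close>, provided that only words of length at least \<open>m = 2 r + 1\<close> are considered
  (\<open>uniformly_recurrent_image\<close>).

  Composition with a power of the shift provides the normalisation that removes the dependence on \<open>r\<close>.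
  Fix a word \<open>v\<close> of \<open>Y\<close> of length \<open>m\<close>. For each of the given factor maps \<open>f\<close>, the sequence \<open>f x\<close>
  contains \<open>v\<close> at some position among the first \<open>2 c m\<close>. The word of \<open>f x\<close> of length
  \<open>L = 3 c\<^sup>2 m\<close> that starts there determines \<open>f\<close> up to a power of the shift
  (\<open>shift_equivalent_if_long_words_agree\<close>). So the number of inequivalent factor maps
  is at most the number of words of length \<open>L\<close> in \<open>Y\<close> that begin with \<open>v\<close>. There are at most \<open>2 c L = 6 c\<^sup>3 m\<close>
  words of length \<open>L\<close> in \<open>Y\<close> by recurrence, and more than \<open>m\<close> words of length \<open>m\<close> because \<open>Y\<close>
  is aperiodic (Morse and Hedlund), so some \<open>v\<close> has at most \<open>6 c\<^sup>3\<close> extensions.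

  The bound \<open>6 c\<^sup>3\<close> is independent of \<open>r\<close>. Hence it bounds the number of all classes of
  factor maps, and \<open>c \<le> K + 1\<close> gives \<open>6 c\<^sup>3 \<le> (2 (K + 1))\<^sup>3\<close>, which is smaller than the bound claimed.
\<close>

section \<open>Words\<close>

definition factor_word :: "(int \<Rightarrow> 'a) \<Rightarrow> int \<Rightarrow> nat \<Rightarrow> 'a list" where
  "factor_word x a n = map (\<lambda>j. x (a + int j)) [0..<n]"

definition words :: "(int \<Rightarrow> 'a) set \<Rightarrow> nat \<Rightarrow> 'a list set" where
  "words X n = {factor_word x a n | x a. x \<in> X}"

lemma length_factor_word [simp]: "length (factor_word x a n) = n"
  by (simp add: factor_word_def)

lemma factor_word_eq_iff:
  "factor_word x a n = factor_word z b n \<longleftrightarrow> (\<forall>j<n. x (a + int j) = z (b + int j))"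
  by (auto simp: factor_word_def)

lemma factor_word_eqD:
  assumes "factor_word x a n = factor_word z b n" "0 \<le> i" "i < int n"
  shows "x (a + i) = z (b + i)"
  using assms by (metis factor_word_eq_iff nat_0_le nat_less_iff)

lemma take_factor_word: "m \<le> n \<Longrightarrow> take m (factor_word x a n) = factor_word x a m"
  by (simp add: factor_word_def take_map)

lemma finite_words [simp]: "finite (words (X :: (int \<Rightarrow> 'a::finite) set) n)"
proof (rule finite_subset)
  show "words X n \<subseteq> {w. set w \<subseteq> UNIV \<and> length w = n}"
    by (auto simp: words_def)
  show "finite {w. set w \<subseteq> (UNIV :: 'a set) \<and> length w = n}"
    by (rule finite_lists_length_eq) simp
qed

lemma mem_occurrences_factor_word:
  "p \<in> occurrences I x (factor_word z b n) \<longleftrightarrow>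
    {p..<p + int n} \<subseteq> I \<and> p \<in> I \<and> factor_word x p n = factor_word z b n"
  by (auto simp: occurrences_def factor_word_eq_iff) (auto simp: factor_word_def)

lemma occurrences_mono: "I \<subseteq> J \<Longrightarrow> occurrences I x u \<subseteq> occurrences J x u"
  by (auto simp: occurrences_def)

lemma factor_word_in_language:
  assumes "z \<in> Omega I x"
  shows "factor_word z b n \<in> language I x"
proof -
  have "b \<in> occurrences UNIV z (factor_word z b n)"
    by (simp add: mem_occurrences_factor_word)
  then have "factor_word z b n \<in> language UNIV z"
    by (auto simp: language_def)
  then show ?thesis
    using assms by (auto simp: Omega_def)
qed

section \<open>Linear recurrence\<close>

text \<open>
  Recurrence supplies arbitrarily late occurrences. They let one-sided sequences be treated like
  two-sided ones: a word may first occur arbitrarily late in a one-sided sequence, and the bound on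
  gaps takes effect only from that first occurrence on.
\<close>

lemma recurrent_occurrence_beyond:
  assumes "recurrent I x" "u \<in> language I x"
  obtains p where "p \<in> occurrences {0..} x u" "q < p"
proof -
  have "infinite (occurrences {0..} x u)"
    using assms by (auto simp: recurrent_def)
  then have "\<not> occurrences {0..} x u \<subseteq> {0..q}"
    using finite_subset by blast
  moreover have "occurrences {0..} x u \<subseteq> {0..}"
    by (auto simp: occurrences_def)
  ultimately show thesis
    using that by (meson atLeastAtMost_iff atLeast_iff not_le subset_iff)
qed

text \<open>
  The bound on gaps between successive occurrences, in the form of a bound on the waiting time from an
  arbitrary position: the last occurrence before \<open>q\<close> and the first one from \<open>q\<close> on are successive.
\<close>

lemma linearly_recurrent_next_occurrence:
  assumes I: "{0..} \<subseteq> I" and lr: "linearly_recurrent I K x"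
    and u: "u \<noteq> []" "p0 \<in> occurrences I x u" "p0 < q"
  obtains h where "h \<in> occurrences I x u" "q \<le> h" "real_of_int (h - q) + 1 \<le> K * real (length u)"
proof -
  let ?O = "occurrences I x u"
  have lang: "u \<in> language I x"
    using u by (auto simp: language_def)
  obtain p1 where p1: "p1 \<in> occurrences {0..} x u" "q < p1"
    using recurrent_occurrence_beyond lr lang unfolding linearly_recurrent_def by metis
  have p1O: "p1 \<in> ?O"
    using occurrences_mono[OF I] p1 by blast
  define l where "l = Max (?O \<inter> {p0..<q})"
  define h where "h = Min (?O \<inter> {q..p1})"
  have l: "l \<in> ?O \<inter> {p0..<q}"
    unfolding l_def by (rule Max_in) (use u in auto)
  have h: "h \<in> ?O \<inter> {q..p1}"
    unfolding h_def by (rule Min_in) (use p1 p1O in auto)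
  have lmax: "p \<le> l" if "p \<in> ?O \<inter> {p0..<q}" for p
    unfolding l_def by (rule Max_ge) (use that in auto)
  have hmin: "h \<le> p" if "p \<in> ?O \<inter> {q..p1}" for p
    unfolding h_def by (rule Min_le) (use that in auto)
  have "p \<notin> ?O" if "l < p" "p < h" for p
  proof
    assume "p \<in> ?O"
    then show False
      using lmax[of p] hmin[of p] that l h by (cases "p < q") auto
  qed
  then have "{l<..<h} \<inter> ?O = {}"
    by auto
  moreover have "l < h" "l \<in> ?O" "h \<in> ?O"
    using l h by auto
  ultimately have "real_of_int (h - l) \<le> K * real (length u)"
    using lr lang u unfolding linearly_recurrent_def by blast
  moreover have "h - q + 1 \<le> h - l"
    using l by auto
  then have "real_of_int (h - q) + 1 \<le> real_of_int (h - l)"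
    by linarith
  ultimately show thesis
    using that h by auto
qed

lemma linearly_recurrent_constant_ge_1:
  assumes I: "{0..} \<subseteq> I" and lr: "linearly_recurrent I K x"
  shows "1 \<le> K"
proof -
  have p: "0 \<in> occurrences I x [x 0]"
    using I by (auto simp: occurrences_def)
  obtain h where "1 \<le> h" "real_of_int (h - 1) + 1 \<le> K * real (length [x 0])"
    using linearly_recurrent_next_occurrence[OF I lr _ p, of 1] by auto
  then show ?thesis
    by simp
qed

text \<open>
  The combinatorial content of linear recurrence, as a property of a set of sequences. The threshold
  \<open>s\<close> on the length of words is what lets a sliding block code preserve the property with
  a constant that is independent of the radius of the code.
\<close>

definition uniformly_recurrent_from :: "nat \<Rightarrow> nat \<Rightarrow> (int \<Rightarrow> 'a) set \<Rightarrow> bool" where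
  "uniformly_recurrent_from s c X \<longleftrightarrow>
     (\<forall>z\<in>X. \<forall>z'\<in>X. \<forall>a b. \<forall>n\<ge>s. \<exists>p. a \<le> p \<and> p < a + int (c * n) \<and>
        factor_word z p n = factor_word z' b n)"

lemma uniformly_recurrent_fromD:
  assumes "uniformly_recurrent_from s c X" "z \<in> X" "z' \<in> X" "s \<le> n"
  obtains p where "a \<le> p" "p < a + int (c * n)" "factor_word z p n = factor_word z' b n"
  using assms unfolding uniformly_recurrent_from_def by blast

text \<open>
  The stretch of \<open>z\<close> of length \<open>c n + n\<close> from \<open>a\<close> occurs in \<open>x\<close> after some occurrence of the
  given word. The bound on gaps then places that word inside the copy, hence inside \<open>z\<close>.
\<close>

lemma linearly_recurrent_imp_uniformly_recurrent:
  assumes I: "{0..} \<subseteq> I" and lr: "linearly_recurrent I K x" and c: "K \<le> real c"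
  shows "uniformly_recurrent_from 1 c (Omega I x)"
  unfolding uniformly_recurrent_from_def
proof (intro ballI allI impI)
  fix z z' a b and n :: nat
  assume z: "z \<in> Omega I x" "z' \<in> Omega I x" and n: "1 \<le> n"
  let ?w = "factor_word z' b n" and ?u = "factor_word z a (c * n + n)"
  obtain p0 where p0: "p0 \<in> occurrences I x ?w"
    using factor_word_in_language[OF z(2)] by (force simp: language_def)
  have "recurrent I x"
    using lr by (simp add: linearly_recurrent_def)
  then obtain q where q: "q \<in> occurrences {0..} x ?u" "p0 < q"
    using recurrent_occurrence_beyond factor_word_in_language[OF z(1)] by metis
  have "?w \<noteq> []"
    using n by (metis length_factor_word list.size(3) not_one_le_zero)
  then obtain h where h: "h \<in> occurrences I x ?w" "q \<le> h" "real_of_int (h - q) + 1 \<le> K * real n"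
    using linearly_recurrent_next_occurrence[OF I lr _ p0 q(2)] by auto
  have "K * real n \<le> real (c * n)"
    using c by (simp add: mult_right_mono)
  then have "real_of_int (h - q) + 1 \<le> real_of_int (int (c * n))"
    using h(3) by (metis of_int_of_nat_eq order_trans)
  then have less: "h - q < int (c * n)"
    by linarith
  have xu: "factor_word x q (c * n + n) = ?u" and xw: "factor_word x h n = ?w"
    using q h by (simp_all add: mem_occurrences_factor_word)
  have "z (a + (h - q) + int j) = z' (b + int j)" if "j < n" for j
  proof -
    have "x (q + (h - q + int j)) = z (a + (h - q + int j))"
      by (rule factor_word_eqD[OF xu]) (use h(2) less that in auto)
    moreover have "x (h + int j) = z' (b + int j)"
      using xw that by (simp add: factor_word_eq_iff)
    ultimately show ?thesis
      by (simp add: algebra_simps)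
  qed
  then have "factor_word z (a + (h - q)) n = ?w"
    by (simp add: factor_word_eq_iff)
  then show "\<exists>p. a \<le> p \<and> p < a + int (c * n) \<and> factor_word z p n = ?w"
    using h(2) less by (intro exI[of _ "a + (h - q)"]) auto
qed

section \<open>Sliding block codes\<close>

text \<open>
  The two positions \<open>k\<close> and \<open>l\<close> are independent, so the condition includes that \<open>f\<close> applies the same local
  rule at every coordinate; on a shift-invariant \<open>X\<close> this means that \<open>f\<close> commutes with the shift.
\<close>

definition block_code_radius :: "(int \<Rightarrow> 'a) set \<Rightarrow> ((int \<Rightarrow> 'a) \<Rightarrow> (int \<Rightarrow> 'b)) \<Rightarrow> nat \<Rightarrow> bool" where
  "block_code_radius X f r \<longleftrightarrow>
     (\<forall>x\<in>X. \<forall>z\<in>X. \<forall>k l. (\<forall>i. \<bar>i\<bar> \<le> int r \<longrightarrow> x (k + i) = z (l + i)) \<longrightarrow> f x k = f z l)"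

lemma block_code_radiusD:
  assumes "block_code_radius X f r" "x \<in> X" "z \<in> X"
    and "\<And>i. \<bar>i\<bar> \<le> int r \<Longrightarrow> x (k + i) = z (l + i)"
  shows "f x k = f z l"
  using assms unfolding block_code_radius_def by blast

lemma block_code_radius_mono:
  assumes "block_code_radius X f r" "r \<le> s"
  shows "block_code_radius X f s"
  unfolding block_code_radius_def
proof (intro ballI allI impI)
  fix x z k l
  assume "x \<in> X" "z \<in> X" and agree: "\<forall>i. \<bar>i\<bar> \<le> int s \<longrightarrow> x (k + i) = z (l + i)"
  show "f x k = f z l"
    by (rule block_code_radiusD[OF assms(1) \<open>x \<in> X\<close> \<open>z \<in> X\<close>]) (use agree assms(2) in simp)
qed

lemma subshift_shift_pow:
  assumes "subshift X" "x \<in> X"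
  shows "shift_pow k x \<in> X"
proof -
  have inv: "shift x \<in> X \<longleftrightarrow> x \<in> X" for x
    using assms(1) unfolding subshift_def by blast
  have step: "shift (shift_pow k x) = shift_pow (k + 1) x" for k
    by (simp add: fun_eq_iff shift_def shift_pow_apply ac_simps)
  show ?thesis
  proof (induction k rule: int_induct[where k = 0])
    case base
    then show ?case
      using assms(2) by (simp add: shift_pow_def)
  next
    case (step1 i)
    then show ?case
      using inv step by metis
  next
    case (step2 i)
    then show ?case
      using inv[of "shift_pow (i - 1) x"] step[of "i - 1"] by simp
  qed
qed

lemma factor_map_shift_pow:
  assumes "subshift X" "factor_map X Y f" "x \<in> X"
  shows "f (shift_pow k x) = shift_pow k (f x)"
proof -
  have eq: "f (shift x) = shift (f x)" if "x \<in> X" for x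
    using assms(2) that by (simp add: factor_map_def)
  have step: "shift (shift_pow k x) = shift_pow (k + 1) x" for k and x :: "int \<Rightarrow> 'c"
    by (simp add: fun_eq_iff shift_def shift_pow_apply ac_simps)
  have mem: "shift_pow k x \<in> X" for k
    using subshift_shift_pow assms by blast
  show ?thesis
  proof (induction k rule: int_induct[where k = 0])
    case base
    then show ?case
      by (simp add: shift_pow_def)
  next
    case (step1 i)
    then show ?case
      using eq[OF mem[of i]] step by metis
  next
    case (step2 i)
    have "shift (f (shift_pow (i - 1) x)) = f (shift_pow i x)"
      using eq[OF mem[of "i - 1"]] step[of "i - 1" x] by simp
    also have "\<dots> = shift (shift_pow (i - 1) (f x))"
      using step2 step[of "i - 1" "f x"] by simp
    finally show ?case
      using eq by (simp add: fun_eq_iff shift_def) (metis diff_add_cancel)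
  qed
qed

lemma openin_full_shift_finite_agreement:
  assumes "finite A"
  shows "openin full_shift_topology {z. \<forall>i\<in>A. z i = x i}"
proof -
  have "{z. \<forall>i\<in>A. z i = x i} = (\<Pi>\<^sub>E i\<in>UNIV. if i \<in> A then {x i} else UNIV)"
    by (auto simp: PiE_def Pi_def split: if_splits)
  moreover have "openin full_shift_topology (\<Pi>\<^sub>E i\<in>UNIV. if i \<in> A then {x i} else UNIV)"
    unfolding full_shift_topology_def openin_PiE_gen
    using assms by (auto intro: finite_subset)
  ultimately show ?thesis
    by simp
qed

lemma openin_full_shift_window:
  assumes "openin full_shift_topology U" "x \<in> U"
  obtains r :: nat where "\<And>z. (\<And>i. \<bar>i\<bar> \<le> int r \<Longrightarrow> z i = x i) \<Longrightarrow> z \<in> U"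
proof -
  obtain V where fin: "finite {i. V i \<noteq> UNIV}" and V: "x \<in> Pi\<^sub>E UNIV V" "Pi\<^sub>E UNIV V \<subseteq> U"
    using assms unfolding full_shift_topology_def openin_product_topology_alt
    by (auto simp: topspace_discrete_topology)
  obtain B where B: "\<And>i. V i \<noteq> UNIV \<Longrightarrow> \<bar>i\<bar> \<le> B"
    using finite_imageI[OF fin, of abs] by (metis (mono_tags, lifting) Max_ge imageI mem_Collect_eq)
  show thesis
  proof (rule that[of "nat B"])
    fix z
    assume z: "\<And>i. \<bar>i\<bar> \<le> int (nat B) \<Longrightarrow> z i = x i"
    have "z i \<in> V i" for i
    proof (cases "V i = UNIV")
      case False
      then have "z i = x i"
        using B[of i] by (intro z) auto
      then show ?thesis
        using V(1) by auto
    qed simp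
    then show "z \<in> U"
      using V(2) by auto
  qed
qed

lemma compactin_subshift:
  fixes X :: "(int \<Rightarrow> 'a::finite) set"
  assumes "subshift X"
  shows "compactin full_shift_topology X"
proof (rule closedin_compact_space)
  show "compact_space (full_shift_topology :: (int \<Rightarrow> 'a) topology)"
    unfolding full_shift_topology_def
    by (simp add: compact_space_product_topology compact_space_discrete_topology)
qed (use assms in \<open>simp add: subshift_def\<close>)

text \<open>
  The theorem of Curtis, Hedlund and Lyndon. By continuity, each \<open>x \<in> X\<close> has a central window that
  determines the coordinate \<open>0\<close> of the image. Finitely many of the corresponding cylinders
  cover the compact set \<open>X\<close>, and a window that contains theirs serves all points of \<open>X\<close>.
\<close>

lemma factor_map_block_code_radius:
  fixes X :: "(int \<Rightarrow> 'a::finite) set"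
  assumes X: "subshift X" and f: "factor_map X Y f"
  obtains r where "block_code_radius X f r"
proof -
  have "\<exists>r. \<forall>z\<in>X. (\<forall>i. \<bar>i\<bar> \<le> int r \<longrightarrow> z i = x i) \<longrightarrow> f z 0 = f x 0" if x: "x \<in> X" for x
  proof -
    have cont: "continuous_map (subtopology full_shift_topology X) full_shift_topology f"
      using f by (auto simp: factor_map_def dest: continuous_map_into_fulltopology)
    have "openin (subtopology full_shift_topology X)
        {z \<in> topspace (subtopology full_shift_topology X). f z \<in> {y. \<forall>i\<in>{0}. y i = f x i}}"
      by (rule openin_continuous_map_preimage[OF cont])
        (rule openin_full_shift_finite_agreement, simp)
    then obtain U where U: "openin full_shift_topology U"
      and eq: "{z \<in> topspace (subtopology full_shift_topology X). f z \<in> {y. \<forall>i\<in>{0}. y i = f x i}} = U \<inter> X"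
      unfolding openin_subtopology by blast
    have top: "topspace (subtopology full_shift_topology X) = X"
      by (simp add: full_shift_topology_def)
    have "x \<in> U"
      using eq x unfolding top by auto
    then obtain r where r: "\<And>z. (\<And>i. \<bar>i\<bar> \<le> int r \<Longrightarrow> z i = x i) \<Longrightarrow> z \<in> U"
      using openin_full_shift_window[OF U] by metis
    have "f z 0 = f x 0" if "z \<in> X" "\<forall>i. \<bar>i\<bar> \<le> int r \<longrightarrow> z i = x i" for z
      using r[of z] that eq unfolding top by blast
    then show ?thesis
      by blast
  qed
  then obtain \<rho> :: "(int \<Rightarrow> 'a) \<Rightarrow> nat"
    where \<rho>: "\<And>x z. \<lbrakk>x \<in> X; z \<in> X; \<And>i. \<bar>i\<bar> \<le> int (\<rho> x) \<Longrightarrow> z i = x i\<rbrakk> \<Longrightarrow> f z 0 = f x 0"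
    by metis
  define C where "C x = {z. \<forall>i\<in>{- int (\<rho> x)..int (\<rho> x)}. z i = x i}" for x
  have "\<exists>\<F>. finite \<F> \<and> \<F> \<subseteq> C ` X \<and> X \<subseteq> \<Union>\<F>"
  proof (rule compactinD[OF compactin_subshift[OF X]])
    show "openin full_shift_topology U" if "U \<in> C ` X" for U
      using that by (auto simp: C_def intro!: openin_full_shift_finite_agreement)
    show "X \<subseteq> \<Union> (C ` X)"
      by (auto simp: C_def)
  qed
  then obtain A where A: "finite A" "A \<subseteq> X" and cover: "X \<subseteq> \<Union> (C ` A)"
    by (metis finite_subset_image)
  \<comment> \<open>The sum serves as an upper bound that needs no case distinction for the empty set.\<close>
  define r where "r = (\<Sum>x\<in>A. \<rho> x)"
  have le: "\<rho> x \<le> r" if "x \<in> A" for x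
    unfolding r_def using A that by (simp add: member_le_sum)
  have zero: "f x 0 = f z 0" if x: "x \<in> X" "z \<in> X" and agree: "\<And>i. \<bar>i\<bar> \<le> int r \<Longrightarrow> x i = z i" for x z
  proof -
    obtain y where y: "y \<in> A" "x \<in> C y"
      using cover x by auto
    have xy: "x i = y i" if "\<bar>i\<bar> \<le> int (\<rho> y)" for i
    proof -
      have "i \<in> {- int (\<rho> y)..int (\<rho> y)}"
        using that by auto
      then show ?thesis
        using y(2) unfolding C_def by blast
    qed
    have zy: "z i = y i" if "\<bar>i\<bar> \<le> int (\<rho> y)" for i
      using xy[OF that] agree[of i] le[OF y(1)] that by auto
    have "y \<in> X"
      using y A by auto
    then show ?thesis
      using \<rho>[of y x] \<rho>[of y z] x xy zy by auto
  qed
  have "block_code_radius X f r"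
    unfolding block_code_radius_def
  proof (intro ballI allI impI)
    fix x z k l
    assume x: "x \<in> X" "z \<in> X" and agree: "\<forall>i. \<bar>i\<bar> \<le> int r \<longrightarrow> x (k + i) = z (l + i)"
    have "f (shift_pow k x) 0 = f (shift_pow l z) 0"
      using zero subshift_shift_pow[OF X] x agree by (simp add: shift_pow_apply add.commute)
    then show "f x k = f z l"
      using factor_map_shift_pow[OF X f] x by (simp add: shift_pow_apply)
  qed
  then show thesis
    using that by blast
qed

text \<open>
  A word of length \<open>n\<close> in the image comes from a word of length \<open>n + 2 r\<close>. The waiting time
  \<open>c (n + 2 r)\<close> for the latter is at most \<open>2 c n\<close> once \<open>n \<ge> 2 r\<close>.
\<close>

lemma uniformly_recurrent_image:
  assumes X: "uniformly_recurrent_from s c X" and f: "block_code_radius X f r"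
    and t: "s \<le> t" "2 * r \<le> t"
  shows "uniformly_recurrent_from t (2 * c) (f ` X)"
  unfolding uniformly_recurrent_from_def
proof (intro ballI allI impI)
  fix y y' a b n
  assume y: "y \<in> f ` X" "y' \<in> f ` X" and n: "t \<le> n"
  obtain x x' where x: "x \<in> X" "x' \<in> X" "y = f x" "y' = f x'"
    using y by auto
  have "s \<le> n + 2 * r"
    using t n by simp
  then obtain p where p: "a - int r \<le> p" "p < a - int r + int (c * (n + 2 * r))"
    and eq: "factor_word x p (n + 2 * r) = factor_word x' (b - int r) (n + 2 * r)"
    using uniformly_recurrent_fromD[OF X x(1,2)] by metis
  have "f x (p + int r + int j) = f x' (b + int j)" if "j < n" for j
  proof (rule block_code_radiusD[OF f x(1,2)])
    fix i
    assume i: "\<bar>i\<bar> \<le> int r"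
    have "x (p + (int r + int j + i)) = x' (b - int r + (int r + int j + i))"
      by (rule factor_word_eqD[OF eq]) (use i that in auto)
    then show "x (p + int r + int j + i) = x' (b + int j + i)"
      by (simp add: algebra_simps)
  qed
  then have "factor_word y (p + int r) n = factor_word y' b n"
    by (simp add: factor_word_eq_iff x)
  moreover have "c * (n + 2 * r) \<le> 2 * c * n"
    using t n by (simp add: mult.assoc)
  then have "p + int r < a + int (2 * c * n)"
    using p(2) by linarith
  ultimately show "\<exists>p. a \<le> p \<and> p < a + int (2 * c * n) \<and> factor_word y p n = factor_word y' b n"
    using p(1) by (intro exI[of _ "p + int r"]) auto
qed

section \<open>Word complexity\<close>

lemma card_words_le:
  assumes "uniformly_recurrent_from s c Y" "s \<le> n"
  shows "card (words Y n) \<le> c * n"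
proof (cases "Y = {}")
  case True
  then show ?thesis
    by (simp add: words_def)
next
  case False
  then obtain y where y: "y \<in> Y"
    by auto
  have "words Y n \<subseteq> (\<lambda>p. factor_word y p n) ` {0..<int (c * n)}"
  proof
    fix w
    assume "w \<in> words Y n"
    then obtain y' b where y': "y' \<in> Y" and w: "w = factor_word y' b n"
      by (auto simp: words_def)
    obtain p where "0 \<le> p" "p < 0 + int (c * n)" "factor_word y p n = factor_word y' b n"
      using uniformly_recurrent_fromD[OF assms(1) y y' assms(2)] .
    then show "w \<in> (\<lambda>p. factor_word y p n) ` {0..<int (c * n)}"
      unfolding w by (intro image_eqI[of _ _ p]) auto
  qed
  then have "card (words Y n) \<le> card {0..<int (c * n)}"
    by (rule surj_card_le[rotated]) simp
  then show ?thesis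
    by (simp del: of_nat_mult)
qed

text \<open>
  The theorem of Morse and Hedlund. If the number of words does not grow from length \<open>n\<close> to
  \<open>n + 1\<close>, then each word of length \<open>n\<close> has a unique extension to the right, so a sequence in \<open>Y\<close>
  is eventually periodic after the first repetition of a word of length \<open>n\<close>. By recurrence, every word
  of the sequence also occurs in its periodic part, which makes the whole sequence periodic.
\<close>

lemma card_words_ge:
  fixes Y :: "(int \<Rightarrow> 'b::finite) set"
  assumes ur: "uniformly_recurrent_from s c Y" and Y: "y \<in> Y" "aperiodic Y"
  shows "n < card (words Y n)"
proof (induction n)
  case 0
  have "words Y 0 = {[]}"
    using Y by (auto simp: words_def factor_word_def)
  then show ?case
    by simp
next
  case (Suc n)
  have img: "words Y n = take n ` words Y (Suc n)"
    unfolding words_def by (force simp: take_factor_word image_iff)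
  have "card (words Y n) < card (words Y (Suc n))"
  proof (rule ccontr)
    assume "\<not> ?thesis"
    moreover have "card (words Y n) \<le> card (words Y (Suc n))"
      unfolding img by (rule card_image_le) simp
    ultimately have "card (words Y n) = card (words Y (Suc n))"
      by simp
    then have inj: "inj_on (take n) (words Y (Suc n))"
      unfolding img by (intro eq_card_imp_inj_on) simp_all
    have extend: "factor_word y k (Suc n) = factor_word y l (Suc n)"
      if "factor_word y k n = factor_word y l n" for k l
    proof (rule inj_onD[OF inj])
      show "take n (factor_word y k (Suc n)) = take n (factor_word y l (Suc n))"
        using that by (simp add: take_factor_word)
    qed (use Y in \<open>auto simp: words_def\<close>)
    have forward: "factor_word y (k + int d) n = factor_word y (l + int d) n"
      if "factor_word y k n = factor_word y l n" for k l d
    proof (induction d)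
      case 0
      then show ?case
        using that by simp
    next
      case (Suc d)
      note longer = extend[OF Suc]
      show ?case
        unfolding factor_word_eq_iff
      proof (intro allI impI)
        fix j
        assume "j < n"
        then show "y (k + int (Suc d) + int j) = y (l + int (Suc d) + int j)"
          using factor_word_eqD[OF longer, of "1 + int j"] by (simp add: algebra_simps)
      qed
    qed
    have "range (\<lambda>k::nat. factor_word y (int k) n) \<subseteq> words Y n"
      using Y by (auto simp: words_def)
    then have "finite (range (\<lambda>k::nat. factor_word y (int k) n))"
      using finite_words finite_subset by blast
    then have "\<not> inj (\<lambda>k::nat. factor_word y (int k) n)"
      using finite_imageD infinite_UNIV_nat by blast
    then obtain k l :: nat where kl: "k < l" "factor_word y (int k) n = factor_word y (int l) n"
      unfolding inj_def by (metis linorder_neqE_nat)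
    define p where "p = l - k"
    have p: "p > 0" "int l = int k + int p"
      using kl(1) by (simp_all add: p_def)
    have eventually_periodic: "y i = y (i + int p)" if "i \<ge> int k + int n" for i
    proof -
      define d where "d = nat (i - (int k + int n))"
      have i: "i = int k + int d + int n"
        using that by (simp add: d_def)
      have "factor_word y (int k + int d) (Suc n) = factor_word y (int l + int d) (Suc n)"
        by (rule extend[OF forward[OF kl(2)]])
      from factor_word_eqD[OF this, of "int n"] show ?thesis
        by (simp add: i p(2) algebra_simps)
    qed
    have "y (i + int p) = y i" for i
    proof -
      \<comment> \<open>The length must exceed \<open>p\<close> to contain both positions \<open>i\<close> and \<open>i + p\<close>, and reach the threshold \<open>s\<close>.\<close>
      have "s \<le> p + s + 1"
        by simp
      then obtain q where q: "int k + int n \<le> q"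
        and eq: "factor_word y q (p + s + 1) = factor_word y i (p + s + 1)"
        using uniformly_recurrent_fromD[OF ur Y(1) Y(1)] by metis
      have "y q = y i"
        using factor_word_eqD[OF eq, of 0] by simp
      moreover have "y (q + int p) = y (i + int p)"
        by (rule factor_word_eqD[OF eq]) auto
      ultimately show ?thesis
        using eventually_periodic[OF q] by simp
    qed
    then have "shift_pow (int p) y = y"
      by (simp add: fun_eq_iff shift_pow_apply)
    then have "(shift ^^ p) y = y"
      by (simp add: shift_pow_def)
    then show False
      using Y p(1) unfolding aperiodic_def by blast
  qed
  then show ?case
    using Suc by simp
qed

lemma card_fibre_le:
  assumes "finite B" "A \<noteq> {}" "finite A" and le: "card B \<le> N * card A"
  shows "\<exists>v\<in>A. card {w \<in> B. g w = v} \<le> N"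
proof (rule ccontr)
  assume "\<not> ?thesis"
  then have many: "Suc N \<le> card {w \<in> B. g w = v}" if "v \<in> A" for v
    using that by (meson not_less_eq_eq)
  have "Suc N * card A = (\<Sum>v\<in>A. Suc N)"
    by simp
  also have "\<dots> \<le> (\<Sum>v\<in>A. card {w \<in> B. g w = v})"
    by (rule sum_mono) (rule many)
  also have "\<dots> = card (\<Union>v\<in>A. {w \<in> B. g w = v})"
    by (rule card_UN_disjoint[symmetric]) (use assms in auto)
  also have "\<dots> \<le> card B"
    by (rule card_mono) (use assms in auto)
  finally have "Suc N * card A \<le> card B" .
  moreover have "0 < card A"
    using assms by (simp add: card_gt_0_iff)
  ultimately show False
    using le by simp
qed

section \<open>Counting factor maps up to the shift\<close>

definition shift_equivalent_on ::
    "(int \<Rightarrow> 'a) set \<Rightarrow> ((int \<Rightarrow> 'a) \<Rightarrow> (int \<Rightarrow> 'b)) \<Rightarrow> ((int \<Rightarrow> 'a) \<Rightarrow> (int \<Rightarrow> 'b)) \<Rightarrow> bool" where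
  "shift_equivalent_on X f g \<longleftrightarrow> (\<exists>k. \<forall>x\<in>X. f x = shift_pow k (g x))"

lemma shift_equivalent_on_refl: "shift_equivalent_on X f f"
  unfolding shift_equivalent_on_def by (rule exI[of _ 0]) (simp add: shift_pow_def)

lemma shift_equivalent_on_sym:
  assumes "shift_equivalent_on X f g"
  shows "shift_equivalent_on X g f"
proof -
  obtain k where "\<forall>x\<in>X. f x = shift_pow k (g x)"
    using assms by (auto simp: shift_equivalent_on_def)
  then have "\<forall>x\<in>X. g x = shift_pow (- k) (f x)"
    by (simp add: fun_eq_iff shift_pow_apply)
  then show ?thesis
    by (auto simp: shift_equivalent_on_def)
qed

text \<open>
  The values \<open>f z (t + p)\<close> and \<open>g z (t + q)\<close> both depend only on the coordinates of \<open>z\<close> in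
  \<open>[t - r, t + G + r)\<close>. That word of \<open>z\<close> has a copy in \<open>x\<close> that starts in
  \<open>[- r, - r + c n)\<close>, and the agreement of \<open>f x\<close> and \<open>g x\<close> on \<open>c n\<close> coordinates covers exactly
  the translates that can arise. Hence \<open>z\<close> inherits the agreement found in the single point \<open>x\<close>.
\<close>

lemma shift_equivalent_if_long_words_agree:
  assumes X: "uniformly_recurrent_from s c X" "x \<in> X"
    and f: "block_code_radius X f r" and g: "block_code_radius X g r"
    and pq: "0 \<le> p" "p < int G" "0 \<le> q" "q < int G"
    and n: "s \<le> n" "G + 2 * r \<le> n"
    and eq: "factor_word (f x) p (c * n) = factor_word (g x) q (c * n)"
  shows "shift_equivalent_on X f g"
proof -
  have shifted: "f z (t + p) = g z (t + q)" if z: "z \<in> X" for z t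
  proof -
    obtain u where u: "- int r \<le> u" "u < - int r + int (c * n)"
      and xz: "factor_word x u n = factor_word z (t - int r) n"
      using uniformly_recurrent_fromD[OF X z n(1)] by metis
    have window: "x (u + int r + e + i) = z (t + e + i)"
      if "0 \<le> e" "e < int G" "\<bar>i\<bar> \<le> int r" for e i
    proof -
      have "x (u + (int r + e + i)) = z (t - int r + (int r + e + i))"
        by (rule factor_word_eqD[OF xz]) (use that n(2) in auto)
      then show ?thesis
        by (simp add: algebra_simps)
    qed
    have "f z (t + p) = f x (u + int r + p)"
      by (rule block_code_radiusD[OF f z X(2)]) (use window pq in simp)
    also have "\<dots> = g x (u + int r + q)"
      using factor_word_eqD[OF eq, of "u + int r"] u by (simp add: ac_simps)
    also have "\<dots> = g z (t + q)"
      by (rule block_code_radiusD[OF g X(2) z]) (use window pq in simp)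
    finally show ?thesis .
  qed
  have "f z = shift_pow (q - p) (g z)" if "z \<in> X" for z
  proof
    fix t
    show "f z t = shift_pow (q - p) (g z) t"
      using shifted[OF that, of "t - p"] by (simp add: shift_pow_apply algebra_simps)
  qed
  then show ?thesis
    by (auto simp: shift_equivalent_on_def)
qed

text \<open>
  Each map is sent to the word of its image of \<open>x\<close> that begins at an occurrence of a fixed word \<open>v\<close>.
  The words that can arise all extend \<open>v\<close>, and averaging over the words of length \<open>m\<close> yields a \<open>v\<close>
  with few extensions.
\<close>

lemma card_inequivalent_factor_maps_le:
  fixes X :: "(int \<Rightarrow> 'a::finite) set" and Y :: "(int \<Rightarrow> 'b::finite) set"
  assumes X: "subshift X" and Y: "aperiodic Y"
    and ur: "uniformly_recurrent_from 1 c X" and c: "1 \<le> c"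
    and fin: "finite \<Phi>" and fm: "\<And>f. f \<in> \<Phi> \<Longrightarrow> factor_map X Y f"
    and ineq: "\<And>f g. \<lbrakk>f \<in> \<Phi>; g \<in> \<Phi>; shift_equivalent_on X f g\<rbrakk> \<Longrightarrow> f = g"
  shows "card \<Phi> \<le> 6 * c ^ 3"
proof (cases "X = {} \<or> \<Phi> = {}")
  case True
  have "card \<Phi> \<le> 1"
  proof (cases "\<Phi> = {}")
    case False
    then have "X = {}"
      using True by simp
    then have "f = g" if "f \<in> \<Phi>" "g \<in> \<Phi>" for f g
      using ineq[OF that] by (simp add: shift_equivalent_on_def)
    then show ?thesis
      using fin by (simp add: card_le_Suc0_iff_eq)
  qed simp
  also have "1 \<le> 6 * c ^ 3"
    using c one_le_power[of c 3] by linarith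
  finally show ?thesis .
next
  case False
  then obtain x f0 where x: "x \<in> X" and f0: "f0 \<in> \<Phi>"
    by auto
  have "\<exists>r. block_code_radius X f r" if "f \<in> \<Phi>" for f
    using factor_map_block_code_radius[OF X fm[OF that]] by blast
  then obtain \<rho> where \<rho>: "\<And>f. f \<in> \<Phi> \<Longrightarrow> block_code_radius X f (\<rho> f)"
    by metis
  define r where "r = (\<Sum>f\<in>\<Phi>. \<rho> f)"
  have r: "block_code_radius X f r" if "f \<in> \<Phi>" for f
    by (rule block_code_radius_mono[OF \<rho>[OF that]]) (simp add: r_def member_le_sum fin that)
  have image: "f ` X = Y" if "f \<in> \<Phi>" for f
    using fm[OF that] by (simp add: factor_map_def)
  define m where "m = 2 * r + 1"
  have urY: "uniformly_recurrent_from m (2 * c) Y"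
    using uniformly_recurrent_image[OF ur r[OF f0], of m] by (simp add: m_def image[OF f0])
  \<comment> \<open>The starting positions of \<open>v\<close> range over \<open>2 c m\<close> values, so a word of \<open>X\<close> that controls all of them
    has length \<open>2 c m + 2 r\<close>, which \<open>3 c m\<close> exceeds.\<close>
  define n where "n = 3 * c * m"
  have n: "1 \<le> n" "2 * c * m + 2 * r \<le> n"
  proof -
    have "m \<le> c * m"
      using c by simp
    then show "1 \<le> n" "2 * c * m + 2 * r \<le> n"
      unfolding n_def by (simp_all add: m_def)
  qed
  have mL: "m \<le> c * n"
    using c by (simp add: n_def)
  have "card (words Y (c * n)) \<le> 2 * c * (c * n)"
    by (rule card_words_le[OF urY mL])
  also have "\<dots> = 6 * c ^ 3 * m"
    by (simp add: n_def power3_eq_cube)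
  also have "\<dots> \<le> 6 * c ^ 3 * card (words Y m)"
  proof (rule mult_left_mono)
    have "f0 x \<in> Y"
      using image[OF f0] x by blast
    then show "m \<le> card (words Y m)"
      using card_words_ge[OF urY _ Y] less_imp_le by blast
  qed simp
  finally have le: "card (words Y (c * n)) \<le> 6 * c ^ 3 * card (words Y m)" .
  have "words Y m \<noteq> {}"
    using x image[OF f0] by (auto simp: words_def)
  then have "\<exists>v\<in>words Y m. card {w \<in> words Y (c * n). take m w = v} \<le> 6 * c ^ 3"
    by (intro card_fibre_le le finite_words)
  then obtain v where v: "v \<in> words Y m"
    and few: "card {w \<in> words Y (c * n). take m w = v} \<le> 6 * c ^ 3"
    by blast
  have "\<exists>p. 0 \<le> p \<and> p < int (2 * c * m) \<and> factor_word (f x) p m = v" if "f \<in> \<Phi>" for f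
  proof -
    obtain y b where y: "y \<in> Y" "v = factor_word y b m"
      using v by (auto simp: words_def)
    have "f x \<in> Y"
      using image[OF that] x by blast
    then obtain p where "0 \<le> p" "p < 0 + int (2 * c * m)" "factor_word (f x) p m = factor_word y b m"
      using uniformly_recurrent_fromD[OF urY _ y(1) order_refl] by metis
    then show ?thesis
      unfolding y(2) by (intro exI[of _ p]) simp
  qed
  then obtain pos where pos: "\<And>f. f \<in> \<Phi> \<Longrightarrow> 0 \<le> pos f" "\<And>f. f \<in> \<Phi> \<Longrightarrow> pos f < int (2 * c * m)"
    "\<And>f. f \<in> \<Phi> \<Longrightarrow> factor_word (f x) (pos f) m = v"
    by metis
  let ?code = "\<lambda>f. factor_word (f x) (pos f) (c * n)"
  have "inj_on ?code \<Phi>"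
  proof (rule inj_onI)
    fix f g
    assume fg: "f \<in> \<Phi>" "g \<in> \<Phi>" "?code f = ?code g"
    have "shift_equivalent_on X f g"
      by (rule shift_equivalent_if_long_words_agree[where f = f and g = g and x = x
          and p = "pos f" and q = "pos g", OF ur x r[OF fg(1)] r[OF fg(2)]
          pos(1,2)[OF fg(1)] pos(1,2)[OF fg(2)] n fg(3)])
    then show "f = g"
      using ineq fg by blast
  qed
  moreover have "?code ` \<Phi> \<subseteq> {w \<in> words Y (c * n). take m w = v}"
  proof (rule image_subsetI)
    fix f
    assume f: "f \<in> \<Phi>"
    have "f x \<in> Y"
      using image[OF f] x by blast
    then have "?code f \<in> words Y (c * n)"
      unfolding words_def by blast
    then show "?code f \<in> {w \<in> words Y (c * n). take m w = v}"
      using pos(3)[OF f] by (simp add: take_factor_word[OF mL])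
  qed
  ultimately have "card \<Phi> \<le> card {w \<in> words Y (c * n). take m w = v}"
    by (rule card_inj_on_le) simp
  then show ?thesis
    using few by simp
qed

text \<open>
  A set of pairwise unrelated elements that has the largest possible size meets every class, since
  otherwise it could be enlarged.
\<close>

lemma finite_representatives:
  assumes refl: "\<And>f. R f f" and sym: "\<And>f g. R f g \<Longrightarrow> R g f"
    and bound: "\<And>\<Phi>. \<lbrakk>finite \<Phi>; \<Phi> \<subseteq> M; \<And>f g. \<lbrakk>f \<in> \<Phi>; g \<in> \<Phi>; R f g\<rbrakk> \<Longrightarrow> f = g\<rbrakk> \<Longrightarrow> card \<Phi> \<le> B"
  obtains \<Phi> where "finite \<Phi>" "\<Phi> \<subseteq> M" "card \<Phi> \<le> B" "\<And>f. f \<in> M \<Longrightarrow> \<exists>g\<in>\<Phi>. R f g"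
proof -
  define P where "P \<Phi> \<longleftrightarrow> finite \<Phi> \<and> \<Phi> \<subseteq> M \<and> (\<forall>f\<in>\<Phi>. \<forall>g\<in>\<Phi>. R f g \<longrightarrow> f = g)" for \<Phi>
  have le: "card \<Phi> \<le> B" if "P \<Phi>" for \<Phi>
    using that bound unfolding P_def by blast
  have "P {}"
    by (simp add: P_def)
  then have "\<exists>\<Phi>. P \<Phi> \<and> (\<forall>\<Psi>. P \<Psi> \<longrightarrow> card \<Psi> \<le> card \<Phi>)"
    using le by (intro ex_has_greatest_nat[of P _ card "Suc B"]) (auto simp: less_Suc_eq_le)
  then obtain \<Phi> where \<Phi>: "P \<Phi>" and max: "\<And>\<Psi>. P \<Psi> \<Longrightarrow> card \<Psi> \<le> card \<Phi>"
    by blast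
  have "\<exists>g\<in>\<Phi>. R f g" if "f \<in> M" for f
  proof (rule ccontr)
    assume none: "\<not> ?thesis"
    then have "f \<notin> \<Phi>"
      using refl by blast
    moreover have "P (insert f \<Phi>)"
      using \<Phi> none that sym unfolding P_def by blast
    ultimately show False
      using max[of "insert f \<Phi>"] \<Phi> by (simp add: P_def)
  qed
  then show thesis
    using that \<Phi> le unfolding P_def by blast
qed

theorem theorem1p5:
  fixes X :: "(int \<Rightarrow> 'a::finite) set"
    and Y :: "(int \<Rightarrow> 'b::finite) set"
    and K :: real
  assumes "subshift X" and "aperiodic X"
    and "subshift Y" and "aperiodic Y"
    and "linearly_recurrent_subshift K X"
  shows "\<exists>(N::nat) (F :: nat \<Rightarrow> (int \<Rightarrow> 'a) \<Rightarrow> (int \<Rightarrow> 'b)).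
           real N \<le> (2 * (K + 1)) powr (36 * (K + 1) ^ 5) \<and>
           (\<forall>i\<in>{1..N}. factor_map X Y (F i)) \<and>
           (\<forall>f. factor_map X Y f \<longrightarrow>
              (\<exists>k::int. \<exists>i\<in>{1..N}. \<forall>x\<in>X. f x = shift_pow k (F i x)))"
proof -
  obtain I x where I: "{0..} \<subseteq> I" and lr: "linearly_recurrent I K x" and XO: "X = Omega I x"
    using assms(5) unfolding linearly_recurrent_subshift_def by auto
  have K: "1 \<le> K"
    by (rule linearly_recurrent_constant_ge_1[OF I lr])
  define c where "c = nat \<lceil>K\<rceil>"
  have c: "K \<le> real c" "real c \<le> K + 1" "1 \<le> c"
    unfolding c_def using K by linarith+
  have ur: "uniformly_recurrent_from 1 c X"
    unfolding XO by (rule linearly_recurrent_imp_uniformly_recurrent[OF I lr c(1)])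
  obtain \<Phi> where \<Phi>: "finite \<Phi>" "\<Phi> \<subseteq> Collect (factor_map X Y)" "card \<Phi> \<le> 6 * c ^ 3"
    and rep: "\<And>f. f \<in> Collect (factor_map X Y) \<Longrightarrow> \<exists>g\<in>\<Phi>. shift_equivalent_on X f g"
  proof (rule finite_representatives)
    show "card \<Phi> \<le> 6 * c ^ 3"
      if "finite \<Phi>" "\<Phi> \<subseteq> Collect (factor_map X Y)"
        "\<And>f g. \<lbrakk>f \<in> \<Phi>; g \<in> \<Phi>; shift_equivalent_on X f g\<rbrakk> \<Longrightarrow> f = g" for \<Phi>
      by (rule card_inequivalent_factor_maps_le[OF assms(1,4) ur c(3) that(1) _ that(3)])
        (use that(2) in auto)
  qed (blast intro: shift_equivalent_on_refl shift_equivalent_on_sym)+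
  obtain F where F: "bij_betw F {1..card \<Phi>} \<Phi>"
    using ex_bij_betw_nat_finite_1[OF \<Phi>(1)] by blast
  have "real (card \<Phi>) \<le> 6 * real c ^ 3"
    using \<Phi>(3) by (metis of_nat_le_iff of_nat_mult of_nat_numeral of_nat_power)
  also have "\<dots> \<le> 8 * (K + 1) ^ 3"
    by (rule mult_mono) (use c(2) K in \<open>auto intro: power_mono\<close>)
  also have "\<dots> = (2 * (K + 1)) powr 3"
  proof -
    have "(2 * (K + 1)) powr 3 = (2 * (K + 1)) ^ 3"
      using K by (intro powr_numeral) simp
    then show ?thesis
      by (simp only: power_mult_distrib) simp
  qed
  also have "\<dots> \<le> (2 * (K + 1)) powr (36 * (K + 1) ^ 5)"
  proof (rule powr_mono)
    have "1 \<le> (K + 1) ^ 5"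
      using K by (intro one_le_power) simp
    then show "3 \<le> 36 * (K + 1) ^ 5"
      by linarith
  qed (use K in simp)
  finally have N: "real (card \<Phi>) \<le> (2 * (K + 1)) powr (36 * (K + 1) ^ 5)" .
  show ?thesis
  proof (rule exI[of _ "card \<Phi>"], rule exI[of _ F], intro conjI ballI allI impI)
    show "factor_map X Y (F i)" if "i \<in> {1..card \<Phi>}" for i
      using bij_betwE[OF F] that \<Phi>(2) by blast
    show "\<exists>k. \<exists>i\<in>{1..card \<Phi>}. \<forall>x\<in>X. f x = shift_pow k (F i x)" if f: "factor_map X Y f" for f
    proof -
      obtain g k where g: "g \<in> \<Phi>" "\<forall>x\<in>X. f x = shift_pow k (g x)"
        using rep f unfolding shift_equivalent_on_def by blast
      moreover obtain i where "i \<in> {1..card \<Phi>}" "F i = g"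
        using F g(1) by (metis bij_betw_imp_surj_on imageE)
      ultimately show ?thesis
        by blast
    qed
  qed (rule N)
qed

end
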